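(* Let $A$ be a commutative associative algebra over $\mathbb{C}$ (product $*$) with identity $\hat1$. Let $\mathfrak g$ be a Lie algebra that acts on $A$ as a Lie algebra of derivations. Let $U$ be a $\mathfrak g$-module such that $\partial:A\to U$ is a $\mathfrak g$-module epimorphism and $\partial(\hat1)=0$. Set $B_{\mathfrak g}=\mathfrak g+\partial(A)$ (direct sum of vector spaces). Then: (i) The vector space $(B_{\mathfrak g},[\,,\,])$ is a left Leibniz algebra under $[u+m,v+n]=[u,v]+u\cdot n$ for $u,v\in\mathfrak g$, $m,n\in\partial(A)$. In addition, $A$ is a $B_{\mathfrak g}$-module under $(u+m)\cdot a=u\cdot a$ for $u\in\mathfrak g$, $m\in\partial(A)$, $a\in A$. (ii) Let $\langle\cdot,\cdot\rangle$ be a symmetric invariant bilinear form on $\mathfrak g$. Then the vector space $A\oplus B_{\mathfrak g}$ is a 1-truncated conformal algebra under the following operations: for $g,g'\in\mathfrak g$, $\lambda,\beta\in B_{\mathfrak g}$, $a,a'\in A$, \begin{align*} &\lambda_0\beta=[\lambda,\beta],\quad \lambda_0a=\lambda\cdot a,\quad a_0\lambda=-\lambda\cdot a,\quad a_0a'=0,\\ &g_1g'=\langle g,g'\rangle\hat1,\quad g_1\partial(a)=g\cdot a,\quad \partial(a)_1g=g\cdot a,\quad \partial(a)_1\partial(a')=0,\\ &a_1a'=0,\quad a_1\lambda=0,\quad \lambda_1a=0. \end{align*} (iii) Assume that $A=\mathbb{C}\hat1\oplus N$ where $N$ is a $\mathfrak g$-submodule of $A$, that $\partial$ is a bijection from $N$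 onto $\partial(N)$, and that $a*a'=0$ for all $a,a'\in N$. Define a $\mathbb{C}$-bilinear map $A\times B_{\mathfrak g}\to B_{\mathfrak g}$, $(a,v)\mapsto a\cdot v$, by $$\hat1\cdot(g+\partial(a'))=g+\partial(a'),\qquad a\cdot(g+\partial(a'))=\partial(g_0a)$$ for $a\in N$, $a'\in A$, $g\in\mathfrak g$. Then $B_{\mathfrak g}$ (with the operations of (i), (ii) and this map) is a vertex $A$-algebroid if and only if $g_0g'_0a+g'_0g_0a=(g_1g')*a$ for all $a\in N$, $g,g'\in\mathfrak g$.
   Context: A left Leibniz algebra is a complex vector space with a bilinear bracket satisfying $[a,[b,c]]=[[a,b],c]+[b,[a,c]]$; a module $M$ over it satisfies $[u,v]\cdot m=u\cdot(v\cdot m)-v\cdot(u\cdot m)$. A bilinear form on $\mathfrak g$ is invariant if $\langle[x,y],z\rangle=\langle x,[y,z]\rangle$. A 1-truncated conformal algebra is a graded vector space $C=C_0\oplus C_1$ with a linear map $\partial:C_0\to C_1$ and bilinear operations $(u,v)\mapsto u_iv$, $i=0,1$, of degree $-i-1$ on $C$ such that for $a\in C_0$, $u,v\in C_1$, $\alpha,\beta,\gamma\in C_0\oplus C_1$, $i=0,1$: $(\partial a)_0=0$, $(\partial a)_1=-a_0$, $\partial(u_0a)=u_0\partial a$; $u_0a=-a_0u$, $u_0v=-v_0u+\partial(u_1v)$, $u_1v=v_1u$; $\alpha_0\beta_i\gamma=\beta_i\alpha_0\gamma+(\alpha_0\beta)_i\gamma$. Here $C_0=A$, $C_1=B_{\mathfrak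 g}$. A vertex $A$-algebroid structure on $B$ (where $A$ is a unital commutative associative algebra and $A\times B\to B$, $(a,v)\mapsto a\cdot v$ is bilinear with $\hat1\cdot v=v$, not necessarily associative) is the same as a 1-truncated conformal algebra structure on $A\oplus B$ with $a_ia'=0$ such that for all $a,a'\in A$, $u,v\in B$: $a\cdot(a'\cdot u)-(a*a')\cdot u=(u_0a)\cdot\partial a'+(u_0a')\cdot\partial a$; $u_0(a\cdot v)-a\cdot(u_0v)=(u_0a)\cdot v$; $u_0(a*a')=a*(u_0a')+(u_0a)*a'$; $a_0(a'\cdot v)=a'*(a_0v)$; $(a\cdot u)_1v=a*(u_1v)-u_0v_0a$; $\partial(a*a')=a\cdot\partial(a')+a'\cdot\partial(a)$.
   Formalization: In (ii), existence of the operations is stated only if ∂(a)=0 implies g·a=0 for all g, since otherwise g_1∂(a)=g·a is not well defined (e.g. U=0, nontrivial action); in (iii), existence of the map A×B→B is stated for nonzero identity. *)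

theory Defs
  imports "HOL-Analysis.Product_Vector"
begin

text \<open>
  Complex vector spaces are given by an additive group together with a scalar multiplication
  by complex numbers satisfying \<^locale>\<open>vector_space\<close>; the direct sum of two of them is the
  product type with the scalar multiplication \<^const>\<open>module_prod.scale\<close>.
\<close>

definition bilinear_map ::
  "(complex \<Rightarrow> 'a::ab_group_add \<Rightarrow> 'a) \<Rightarrow> (complex \<Rightarrow> 'b::ab_group_add \<Rightarrow> 'b) \<Rightarrow>
   (complex \<Rightarrow> 'c::ab_group_add \<Rightarrow> 'c) \<Rightarrow> ('a \<Rightarrow> 'b \<Rightarrow> 'c) \<Rightarrow> bool" where
  "bilinear_map sa sb sc f \<longleftrightarrow>
     (\<forall>x. Vector_Spaces.linear sb sc (\<lambda>y. f x y)) \<and>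
     (\<forall>y. Vector_Spaces.linear sa sc (\<lambda>x. f x y))"

text \<open>The identity \<open>e\<close> is a parameter, instead of the constant \<open>1\<close> of \<^class>\<open>comm_ring_1\<close>,
  so that the zero algebra is not excluded.\<close>

locale unital_comm_algebra = vector_space sA
  for sA :: "complex \<Rightarrow> 'a::comm_ring \<Rightarrow> 'a" +
  fixes e :: 'a
  assumes scale_mult: "sA c x * y = sA c (x * y)"
    and unit_mult: "e * x = x"

locale lie_algebra =
  fixes s :: "complex \<Rightarrow> 'g::ab_group_add \<Rightarrow> 'g" and br :: "'g \<Rightarrow> 'g \<Rightarrow> 'g"
  assumes bilinear: "bilinear_map s s s br"
    and alternating: "br x x = 0"
    and jacobi: "br x (br y z) + br y (br z x) + br z (br x y) = 0"

locale left_leibniz_algebra =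
  fixes s :: "complex \<Rightarrow> 'g::ab_group_add \<Rightarrow> 'g" and br :: "'g \<Rightarrow> 'g \<Rightarrow> 'g"
  assumes bilinear: "bilinear_map s s s br"
    and leibniz: "br a (br b c) = br (br a b) c + br b (br a c)"

text \<open>The module identity is the same for Lie algebras and for left Leibniz algebras.\<close>

locale bracket_module =
  fixes s :: "complex \<Rightarrow> 'g::ab_group_add \<Rightarrow> 'g" and br :: "'g \<Rightarrow> 'g \<Rightarrow> 'g"
    and sM :: "complex \<Rightarrow> 'm::ab_group_add \<Rightarrow> 'm" and act :: "'g \<Rightarrow> 'm \<Rightarrow> 'm"
  assumes bilinear: "bilinear_map s sM sM act"
    and bracket_act: "act (br u v) m = act u (act v m) - act v (act u m)"

definition acts_by_derivations ::
  "(complex \<Rightarrow> 'g::ab_group_add \<Rightarrow> 'g) \<Rightarrow> ('g \<Rightarrow> 'g \<Rightarrow> 'g) \<Rightarrow>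
   (complex \<Rightarrow> 'a::comm_ring \<Rightarrow> 'a) \<Rightarrow> ('g \<Rightarrow> 'a \<Rightarrow> 'a) \<Rightarrow> bool" where
  "acts_by_derivations s br sA act \<longleftrightarrow>
     bracket_module s br sA act \<and>
     (\<forall>x a b. act x (a * b) = act x a * b + a * act x b)"

definition symmetric_invariant_form ::
  "(complex \<Rightarrow> 'g::ab_group_add \<Rightarrow> 'g) \<Rightarrow> ('g \<Rightarrow> 'g \<Rightarrow> 'g) \<Rightarrow> ('g \<Rightarrow> 'g \<Rightarrow> complex) \<Rightarrow> bool" where
  "symmetric_invariant_form s br form \<longleftrightarrow>
     bilinear_map s s (*) form \<and>
     (\<forall>x y. form x y = form y x) \<and>
     (\<forall>x y z. form (br x y) z = form x (br y z))"

text \<open>The graded space \<open>C = C\<^sub>0 \<oplus> C\<^sub>1\<close> is a product type; all components outside the degrees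
  0 and 1 are zero.\<close>

abbreviation (input) inA :: "'a \<Rightarrow> 'a \<times> 'b::zero" where "inA a \<equiv> (a, 0)"
abbreviation (input) inB :: "'b \<Rightarrow> 'a::zero \<times> 'b" where "inB v \<equiv> (0, v)"

definition component :: "int \<Rightarrow> ('a::zero \<times> 'b::zero) set" where
  "component n = (if n = 0 then range inA else if n = 1 then range inB else {0})"

text \<open>\<open>p i u v\<close> is the \<open>i\<close>-th product of \<open>u\<close> and \<open>v\<close>; only \<open>i = 0\<close> and \<open>i = 1\<close> are relevant.\<close>

locale one_truncated_conformal_algebra =
  fixes s0 :: "complex \<Rightarrow> 'a::ab_group_add \<Rightarrow> 'a"
    and s1 :: "complex \<Rightarrow> 'b::ab_group_add \<Rightarrow> 'b"
    and d :: "'a \<Rightarrow> 'b"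
    and p :: "nat \<Rightarrow> 'a \<times> 'b \<Rightarrow> 'a \<times> 'b \<Rightarrow> 'a \<times> 'b"
  assumes linear_d: "Vector_Spaces.linear s0 s1 d"
    and bilinear: "i \<in> {0, 1} \<Longrightarrow>
      bilinear_map (module_prod.scale s0 s1) (module_prod.scale s0 s1) (module_prod.scale s0 s1) (p i)"
    and degree: "\<lbrakk>i \<in> {0, 1}; x \<in> component m; y \<in> component n\<rbrakk> \<Longrightarrow>
      p i x y \<in> component (m + n - int i - 1)"
    and d_0: "p 0 (inB (d a)) x = 0"
    and d_1: "p 1 (inB (d a)) x = - p 0 (inA a) x"
    and d_comm: "inB (d (fst (p 0 (inB u) (inA a)))) = p 0 (inB u) (inB (d a))"
    and skew_0_10: "p 0 (inB u) (inA a) = - p 0 (inA a) (inB u)"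
    and skew_0_11: "p 0 (inB u) (inB v) = - p 0 (inB v) (inB u) + inB (d (fst (p 1 (inB u) (inB v))))"
    and sym_1: "p 1 (inB u) (inB v) = p 1 (inB v) (inB u)"
    and commutator: "i \<in> {0, 1} \<Longrightarrow> p 0 x (p i y z) = p i y (p 0 x z) + p i (p 0 x y) z"

locale vertex_algebroid =
  unital_comm_algebra sA e + one_truncated_conformal_algebra sA sB d p
  for sA :: "complex \<Rightarrow> 'a::comm_ring \<Rightarrow> 'a" and e :: 'a
    and sB :: "complex \<Rightarrow> 'b::ab_group_add \<Rightarrow> 'b"
    and d :: "'a \<Rightarrow> 'b"
    and p :: "nat \<Rightarrow> 'a \<times> 'b \<Rightarrow> 'a \<times> 'b \<Rightarrow> 'a \<times> 'b" +
  fixes dot :: "'a \<Rightarrow> 'b \<Rightarrow> 'b"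
  assumes bilinear_dot: "bilinear_map sA sB sB dot"
    and unit_dot: "dot e v = v"
    and AA: "i \<in> {0, 1} \<Longrightarrow> p i (inA a) (inA a') = 0"
    and dot_assoc: "dot a (dot a' u) - dot (a * a') u =
      dot (fst (p 0 (inB u) (inA a))) (d a') + dot (fst (p 0 (inB u) (inA a'))) (d a)"
    and zero_dot: "snd (p 0 (inB u) (inB (dot a v))) - dot a (snd (p 0 (inB u) (inB v))) =
      dot (fst (p 0 (inB u) (inA a))) v"
    and zero_mult: "fst (p 0 (inB u) (inA (a * a'))) =
      a * fst (p 0 (inB u) (inA a')) + fst (p 0 (inB u) (inA a)) * a'"
    and zero_A_dot: "fst (p 0 (inA a) (inB (dot a' v))) = a' * fst (p 0 (inA a) (inB v))"
    and one_dot: "fst (p 1 (inB (dot a u)) (inB v)) =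
      a * fst (p 1 (inB u) (inB v)) - fst (p 0 (inB u) (p 0 (inB v) (inA a)))"
    and d_mult: "d (a * a') = dot a (d a') + dot a' (d a)"

text \<open>
  Let \<open>B\<close> be the direct sum of the Lie algebra and \<open>\<partial>(A)\<close>. Since \<open>\<partial> : A \<rightarrow> U\<close> is surjective, \<open>\<partial>(A)\<close>
  is all of \<open>U\<close>, so \<open>B\<close> is the product type \<open>'g \<times> 'u\<close>.
\<close>

definition B_bracket ::
  "('g \<Rightarrow> 'g \<Rightarrow> 'g) \<Rightarrow> ('g \<Rightarrow> 'u \<Rightarrow> 'u) \<Rightarrow> 'g \<times> 'u \<Rightarrow> 'g \<times> 'u \<Rightarrow> 'g \<times> 'u" where
  "B_bracket br actU = (\<lambda>(u, m) (v, n). (br u v, actU u n))"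

definition B_act :: "('g \<Rightarrow> 'a \<Rightarrow> 'a) \<Rightarrow> 'g \<times> 'u \<Rightarrow> 'a \<Rightarrow> 'a" where
  "B_act actA = (\<lambda>(u, m) a. actA u a)"

text \<open>
  The products on \<open>A \<oplus> B\<close> are prescribed on \<open>A\<close>, the Lie algebra and \<open>\<partial>(A)\<close>, and extended
  bilinearly. They are given by a predicate because \<open>g\<^sub>1\<partial>(a) = g\<cdot>a\<close> depends on the choice of \<open>a\<close>:
  bilinear products satisfying it exist only if \<open>\<partial>(a) = 0\<close> implies \<open>g\<cdot>a = 0\<close>.
\<close>

definition prescribed_products ::
  "(complex \<Rightarrow> 'a::ab_group_add \<Rightarrow> 'a) \<Rightarrow> 'a \<Rightarrow>
   (complex \<Rightarrow> 'g::ab_group_add \<Rightarrow> 'g) \<Rightarrow> ('g \<Rightarrow> 'g \<Rightarrow> 'g) \<Rightarrow> ('g \<Rightarrow> 'a \<Rightarrow> 'a) \<Rightarrow>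
   (complex \<Rightarrow> 'u::ab_group_add \<Rightarrow> 'u) \<Rightarrow> ('g \<Rightarrow> 'u \<Rightarrow> 'u) \<Rightarrow> ('a \<Rightarrow> 'u) \<Rightarrow>
   ('g \<Rightarrow> 'g \<Rightarrow> complex) \<Rightarrow>
   (nat \<Rightarrow> 'a \<times> ('g \<times> 'u) \<Rightarrow> 'a \<times> ('g \<times> 'u) \<Rightarrow> 'a \<times> ('g \<times> 'u)) \<Rightarrow> bool" where
  "prescribed_products sA e sg br actA sU actU d form p \<longleftrightarrow>
     (let s = module_prod.scale sA (module_prod.scale sg sU) in
       bilinear_map s s s (p 0) \<and> bilinear_map s s s (p 1)) \<and>
     (\<forall>\<mu> \<beta>. p 0 (inB \<mu>) (inB \<beta>) = inB (B_bracket br actU \<mu> \<beta>)) \<and>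
     (\<forall>\<mu> a. p 0 (inB \<mu>) (inA a) = inA (B_act actA \<mu> a)) \<and>
     (\<forall>a \<mu>. p 0 (inA a) (inB \<mu>) = inA (- B_act actA \<mu> a)) \<and>
     (\<forall>a a'. p 0 (inA a) (inA a') = 0) \<and>
     (\<forall>g g'. p 1 (inB (g, 0)) (inB (g', 0)) = inA (sA (form g g') e)) \<and>
     (\<forall>g a. p 1 (inB (g, 0)) (inB (0, d a)) = inA (actA g a)) \<and>
     (\<forall>a g. p 1 (inB (0, d a)) (inB (g, 0)) = inA (actA g a)) \<and>
     (\<forall>a a'. p 1 (inB (0, d a)) (inB (0, d a')) = 0) \<and>
     (\<forall>a a'. p 1 (inA a) (inA a') = 0) \<and>
     (\<forall>a \<mu>. p 1 (inA a) (inB \<mu>) = 0) \<and>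
     (\<forall>\<mu> a. p 1 (inB \<mu>) (inA a) = 0)"

definition prescribed_dot ::
  "(complex \<Rightarrow> 'a::ab_group_add \<Rightarrow> 'a) \<Rightarrow> 'a \<Rightarrow> (complex \<Rightarrow> 'g::ab_group_add \<Rightarrow> 'g) \<Rightarrow>
   ('g \<Rightarrow> 'a \<Rightarrow> 'a) \<Rightarrow> (complex \<Rightarrow> 'u::ab_group_add \<Rightarrow> 'u) \<Rightarrow> ('a \<Rightarrow> 'u) \<Rightarrow> 'a set \<Rightarrow>
   ('a \<Rightarrow> 'g \<times> 'u \<Rightarrow> 'g \<times> 'u) \<Rightarrow> bool" where
  "prescribed_dot sA e sg actA sU d N dot \<longleftrightarrow>
     bilinear_map sA (module_prod.scale sg sU) (module_prod.scale sg sU) dot \<and>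
     (\<forall>g a'. dot e (g, d a') = (g, d a')) \<and>
     (\<forall>a\<in>N. \<forall>g a'. dot a (g, d a') = (0, d (actA g a)))"

definition complements :: "'a::ab_group_add set \<Rightarrow> 'a set \<Rightarrow> bool" where
  "complements S T \<longleftrightarrow> S \<inter> T = {0} \<and> (\<forall>x. \<exists>s\<in>S. \<exists>t\<in>T. x = s + t)"

end

theory Submission
  imports Defs
begin

text \<open>
  Invariance of the form and \<open>g \<cdot> e = 0\<close> (a derivation kills the identity) give the conformal
  axioms. For the algebroid, every element of \<open>A\<close> is \<open>c e + n\<close> with \<open>n \<in> N\<close>; the axioms hold
  trivially at \<open>e\<close>, and for \<open>a \<in> N\<close> products with elements of \<open>N\<close> vanish. The only axiom that
  does not become automatic is the one for \<open>(a \<cdot> u)\<^sub>1 v\<close>: with \<open>u = g'\<close> and \<open>v = g\<close> it reads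
  \<open>g g' a = \<langle>g', g\<rangle> a - g' g a\<close>, which is the stated identity.
\<close>

section \<open>Bilinear maps as equations\<close>

lemma bilinear_map_iff:
  "bilinear_map sa sb sc f \<longleftrightarrow>
     vector_space sa \<and> vector_space sb \<and> vector_space sc \<and>
     (\<forall>x y z. f (x + y) z = f x z + f y z) \<and> (\<forall>x y z. f x (y + z) = f x y + f x z) \<and>
     (\<forall>c x y. f (sa c x) y = sc c (f x y)) \<and> (\<forall>c x y. f x (sb c y) = sc c (f x y))"
  unfolding bilinear_map_def Vector_Spaces.linear_iff by (rule iffI) auto

text \<open>Later proofs pick these facts by index: 1 and 2 are additivity, 3 and 4 vanishing at 0,
  9 and 10 homogeneity.\<close>

lemma bilinear_map_additive:
  assumes "bilinear_map sa sb sc f"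
  shows "f (x + x') y = f x y + f x' y" and "f x (y + y') = f x y + f x y'"
    and "f 0 y = 0" and "f x 0 = 0"
    and "f (- x) y = - f x y" and "f x (- y) = - f x y"
    and "f (x - x') y = f x y - f x' y" and "f x (y - y') = f x y - f x y'"
    and "f (sa c x) y = sc c (f x y)" and "f x (sb c y) = sc c (f x y)"
proof -
  interpret l: Vector_Spaces.linear sa sc "\<lambda>x. f x y" for y
    using assms by (simp add: bilinear_map_def)
  interpret r: Vector_Spaces.linear sb sc "\<lambda>y. f x y" for x
    using assms by (simp add: bilinear_map_def)
  show "f (x + x') y = f x y + f x' y" "f 0 y = 0" "f (- x) y = - f x y"
    "f (x - x') y = f x y - f x' y" "f (sa c x) y = sc c (f x y)"
    by (rule l.add l.zero l.neg l.diff l.scale)+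
  show "f x (y + y') = f x y + f x y'" "f x 0 = 0" "f x (- y) = - f x y"
    "f x (y - y') = f x y - f x y'" "f x (sb c y) = sc c (f x y)"
    by (rule r.add r.zero r.neg r.diff r.scale)+
qed

section \<open>Standing data and elementary identities in \<open>A\<close> and the Lie
  algebra\<close>

locale algebroid_data =
  A: unital_comm_algebra sA e + lie_algebra sg br +
  U: bracket_module sg br sU actU + d: Vector_Spaces.linear sA sU d
  for sA :: "complex \<Rightarrow> 'a::comm_ring \<Rightarrow> 'a" and e :: 'a
    and sg :: "complex \<Rightarrow> 'g::ab_group_add \<Rightarrow> 'g" and br :: "'g \<Rightarrow> 'g \<Rightarrow> 'g"
    and actA :: "'g \<Rightarrow> 'a \<Rightarrow> 'a"
    and sU :: "complex \<Rightarrow> 'u::ab_group_add \<Rightarrow> 'u" and actU :: "'g \<Rightarrow> 'u \<Rightarrow> 'u"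
    and d :: "'a \<Rightarrow> 'u" +
  assumes derivations: "acts_by_derivations sg br sA actA"
    and d_act: "d (actA x a) = actU x (d a)"
    and surj_d: "surj d"
    and d_unit: "d e = 0"
begin

abbreviation sB where "sB \<equiv> module_prod.scale sg sU"
abbreviation sC where "sC \<equiv> module_prod.scale sA sB"
abbreviation dB where "dB \<equiv> \<lambda>a. (0 :: 'g, d a)"

lemma actA_bilinear: "bilinear_map sg sA sA actA"
  and actA_bracket: "actA (br x y) a = actA x (actA y a) - actA y (actA x a)"
  and actA_mult: "actA x (a * b) = actA x a * b + a * actA x b"
  using derivations by (auto simp: acts_by_derivations_def bracket_module_def)

lemmas br_simps = bilinear_map_additive[OF bilinear]
lemmas actA_simps = bilinear_map_additive[OF actA_bilinear]
lemmas actU_simps = bilinear_map_additive[OF U.bilinear]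
lemmas d_simps = d.add d.zero d.neg d.diff d.scale

lemma vector_space_sg: "vector_space sg"
  using bilinear by (simp add: bilinear_map_iff)

lemma vector_space_sU: "vector_space sU" ..

sublocale B: vector_space_prod sg sU
  using vector_space_sg vector_space_sU by (simp add: vector_space_prod_def vector_space_pair_def)

sublocale C: vector_space_prod sA sB
  by (simp add: vector_space_prod_def vector_space_pair_def A.vector_space_axioms
      B.p.vector_space_axioms)

text \<open>Polarization: expanding the vanishing bracket of \<open>x + y\<close> with itself leaves
  the two mixed terms.\<close>

lemma br_skew: "br x y = - br y x"
proof -
  have "br (x + y) (x + y) = 0"
    by (rule alternating)
  then show ?thesis
    unfolding br_simps(1,2) eq_neg_iff_add_eq_0 by (simp add: alternating add.commute)
qed

text \<open>The Jacobi identity with two of its terms turned around by skew-symmetry.\<close>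

lemma br_leibniz: "br x (br y z) = br (br x y) z + br y (br x z)"
proof -
  have "br x (br y z) + br y (br z x) + br z (br x y) = 0"
    by (rule jacobi)
  moreover have "br y (br z x) = - br y (br x z)"
    by (metis br_skew br_simps(6))
  moreover have "br z (br x y) = - br (br x y) z"
    by (rule br_skew)
  ultimately show ?thesis
    by (simp add: algebra_simps)
qed

lemma mult_unit: "x * e = x"
  by (metis A.unit_mult mult.commute)

lemma mult_scale: "x * sA c y = sA c (x * y)"
  by (metis A.scale_mult mult.commute)

text \<open>Applying the derivation to \<open>e * e = e\<close> gives
  \<open>actA g e = actA g e + actA g e\<close>.\<close>

lemma act_unit: "actA g e = 0"
  using actA_mult[of g e e] by (simp add: A.unit_mult mult_unit)

section \<open>The left Leibniz algebra \<open>B\<close> and its module \<open>A\<close>\<close>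

text \<open>The first component is the Jacobi identity in Leibniz form, the second the module
  identity of \<open>U\<close>, because the \<open>U\<close>-part of a left factor acts as
  0.\<close>

lemma B_leibniz: "left_leibniz_algebra sB (B_bracket br actU)"
proof
  show "bilinear_map sB sB sB (B_bracket br actU)"
    by (auto simp: bilinear_map_iff B_bracket_def B.p.vector_space_axioms B.scale_def
        br_simps actU_simps split: prod.splits)
  show "B_bracket br actU a (B_bracket br actU b c) =
    B_bracket br actU (B_bracket br actU a b) c + B_bracket br actU b (B_bracket br actU a c)"
    for a b c
    by (auto simp: B_bracket_def U.bracket_act intro: br_leibniz split: prod.splits)
qed

lemma B_module: "bracket_module sB (B_bracket br actU) sA (B_act actA)"
proof
  show "bilinear_map sB sA sA (B_act actA)"
    by (auto simp: bilinear_map_iff B_act_def B.p.vector_space_axioms A.vector_space_axioms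
        B.scale_def actA_simps split: prod.splits)
  show "B_act actA (B_bracket br actU u v) m =
    B_act actA u (B_act actA v m) - B_act actA v (B_act actA u m)" for u v m
    by (auto simp: B_act_def B_bracket_def actA_bracket split: prod.splits)
qed

section \<open>Existence of the prescribed products\<close>

context
  fixes form :: "'g \<Rightarrow> 'g \<Rightarrow> complex"
  assumes form: "symmetric_invariant_form sg br form"
begin

lemma form_bilinear: "bilinear_map sg sg (*) form"
  and form_sym: "form x y = form y x"
  and form_inv: "form (br x y) z = form x (br y z)"
  using form unfolding symmetric_invariant_form_def by blast+

lemmas form_simps = bilinear_map_additive[OF form_bilinear]

text \<open>By \<open>ker\<close> the action on \<open>A\<close> factors through \<open>d\<close>,
  so that the Lie algebra pairs with \<open>U\<close> into \<open>A\<close>; this pairing is the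
  mixed part of the first product.\<close>

lemma products_exist:
  assumes ker: "\<And>a g. d a = 0 \<Longrightarrow> actA g a = 0"
  shows "\<exists>p. prescribed_products sA e sg br actA sU actU d form p"
proof -
  \<comment> \<open>\<open>inv d m\<close> is an arbitrary preimage of \<open>m\<close>; two
    preimages differ by an element of the kernel of \<open>d\<close>, so by \<open>ker\<close> the
    choice does not matter.\<close>
  define act' where "act' g m = actA g (inv d m)" for g m
  have act'_d: "act' g (d a) = actA g a" for g a
  proof -
    have "d (inv d (d a) - a) = 0"
      by (simp add: d_simps surj_f_inv_f[OF surj_d])
    then show ?thesis
      using ker[of "inv d (d a) - a" g] by (simp add: act'_def actA_simps)
  qed
  have ex_d: "\<exists>a. m = d a" for m
    using surj_d by (rule surjD)
  have act'_add: "act' g (m + n) = act' g m + act' g n" for g m n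
    by (metis ex_d act'_d d.add actA_simps(2))
  have act'_scale: "act' g (sU c m) = sA c (act' g m)" for g c m
    by (metis ex_d act'_d d.scale actA_simps(10))
  have act'_add': "act' (g + h) m = act' g m + act' h m"
    and act'_scale': "act' (sg c g) m = sA c (act' g m)" for g h c m
    by (simp_all add: act'_def actA_simps)
  have act'_0: "act' g 0 = 0" for g
    by (metis act'_d d.zero actA_simps(4))
  \<comment> \<open>Bilinear extension of the prescribed values to triples. The first product has
    degree -2, hence only a component in \<open>A\<close>.\<close>
  define p0 where "p0 = (\<lambda>(a, g, m :: 'u) (b, h, n). (actA g b - actA h a, br g h, actU g n))"
  define p1 where "p1 = (\<lambda>(a :: 'a, g, m) (b :: 'a, h, n).
    (sA (form g h) e + act' g n + act' h m, 0 :: 'g, 0 :: 'u))"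
  define p where "p i = (if i = (0 :: nat) then p0 else p1)" for i
  have "bilinear_map sC sC sC p0"
    by (auto simp: bilinear_map_iff p0_def C.p.vector_space_axioms C.scale_def B.scale_def
        actA_simps br_simps actU_simps A.scale_right_diff_distrib split: prod.splits)
  moreover have "bilinear_map sC sC sC p1"
    by (auto simp: bilinear_map_iff p1_def C.p.vector_space_axioms C.scale_def B.scale_def
        act'_add act'_scale act'_add' act'_scale' form_simps algebra_simps
        B.vs1.scale_zero_right d.vs2.scale_zero_right split: prod.splits)
  ultimately have "prescribed_products sA e sg br actA sU actU d form p"
    by (auto simp: prescribed_products_def p_def p0_def p1_def B_bracket_def B_act_def zero_prod_def
        actA_simps br_simps actU_simps form_simps act'_d act'_0 act'_def[of 0] split: prod.splits)
  then show ?thesis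
    by blast
qed

section \<open>Products in coordinates and the conformal axioms\<close>

context
  fixes p :: "nat \<Rightarrow> 'a \<times> ('g \<times> 'u) \<Rightarrow> 'a \<times> ('g \<times> 'u) \<Rightarrow> 'a \<times> ('g \<times> 'u)"
  assumes p: "prescribed_products sA e sg br actA sU actU d form p"
begin

lemma p_bilinear: "bilinear_map sC sC sC (p 0)" "bilinear_map sC sC sC (p 1)"
  using p by (simp_all add: prescribed_products_def Let_def)

lemma p_0: "p 0 (a, g, m) (b, h, n) = (actA g b - actA h a, br g h, actU g n)"
proof -
  have "p 0 ((a, 0) + (0, (g, m))) ((b, 0) + (0, (h, n))) =
      (actA g b - actA h a, br g h, actU g n)"
    unfolding bilinear_map_additive(1,2)[OF p_bilinear(1)]
    using p by (simp add: prescribed_products_def B_bracket_def B_act_def zero_prod_def)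
  then show ?thesis
    by simp
qed

text \<open>The components in \<open>U\<close> are written as \<open>d x\<close> and
  \<open>d y\<close> because the values are prescribed on the image of \<open>d\<close>;
  surjectivity of \<open>d\<close> makes this cover everything.\<close>

lemma p_1: "p (Suc 0) (a, g, d x) (b, h, d y) = (sA (form g h) e + actA g y + actA h x, 0, 0)"
proof -
  have "p 1 ((a, 0) + ((0, (g, 0)) + (0, (0, d x)))) ((b, 0) + ((0, (h, 0)) + (0, (0, d y)))) =
      (sA (form g h) e + actA g y + actA h x, 0, 0)"
    unfolding bilinear_map_additive(1,2)[OF p_bilinear(2)]
    using p by (simp add: prescribed_products_def zero_prod_def)
  then show ?thesis
    by simp
qed

lemma C_cases:
  obtains a g m where "x = (a, g, d m)"
  using surj_d by (metis surjD prod_cases3)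

lemma B_cases:
  obtains g m where "x = (g, d m)"
  using surj_d by (metis surjD surj_pair)

lemma p_0_d: "p 0 (a, g, m) (b, h, d y) = (actA g b - actA h a, br g h, d (actA g y))"
  by (simp add: p_0 d_act)

text \<open>Each identity is compared in coordinates. Values of the form matter in three of them: in
  \<open>skew_0_11\<close>, where \<open>d e = 0\<close> removes them, in \<open>sym_1\<close>, by
  symmetry, and in \<open>commutator\<close> for \<open>i = 1\<close>, by invariance.\<close>

lemma conformal: "one_truncated_conformal_algebra sA sB dB p"
proof (rule one_truncated_conformal_algebra.intro)
  show "Vector_Spaces.linear sA sB dB"
    by (simp add: Vector_Spaces.linear_iff A.vector_space_axioms B.p.vector_space_axioms B.scale_def d_simps
        B.vs1.scale_zero_right)
next
  show "bilinear_map sC sC sC (p i)" if "i \<in> {0, 1}" for i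
    using that p_bilinear by auto
next
  fix i :: nat and x y :: "'a \<times> 'g \<times> 'u" and m n
  assume *: "i \<in> {0, 1}" "x \<in> component m" "y \<in> component n"
  have zero: "p i 0 z = 0" "p i z 0 = 0" for z
    using * p_bilinear bilinear_map_additive(3,4) by blast+
  have zero_component: "0 \<in> component k" for k
    by (auto simp: component_def zero_prod_def)
  have AA: "p i (inA a) (inA b) = 0" for a b
    using * p by (auto simp: prescribed_products_def)
  \<comment> \<open>\<open>component\<close> is \<open>{0}\<close> outside degrees 0 and 1, so a
    factor of any other degree falls under the first two cases.\<close>
  consider "x = 0" | "y = 0" | a b where "m = 0" "n = 0" "x = inA a" "y = inA b"
    | a v where "m = 0" "n = 1" "x = inA a" "y = inB v"
    | u b where "m = 1" "n = 0" "x = inB u" "y = inA b"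
    | u v where "m = 1" "n = 1" "x = inB u" "y = inB v"
    using *(2,3) by (auto simp: component_def split: if_splits)
  then show "p i x y \<in> component (m + n - int i - 1)"
  proof cases
    case 4
    with * p show ?thesis
      by (cases v) (auto simp: prescribed_products_def component_def)
  next
    case 5
    with * p show ?thesis
      by (cases u) (auto simp: prescribed_products_def component_def)
  next
    case 6
    then show ?thesis
      using * p by (cases u rule: B_cases; cases v rule: B_cases)
        (auto simp: prescribed_products_def component_def p_1 zero_prod_def)
  qed (simp_all add: zero AA zero_component)
next
  show "p 0 (inB (dB a)) x = 0" for a x
    by (cases x rule: C_cases) (simp add: p_0_d actA_simps br_simps d_simps zero_prod_def)
next
  show "p 1 (inB (dB a)) x = - p 0 (inA a) x" for a x
    by (cases x rule: C_cases)
      (simp add: p_0_d p_1 actA_simps br_simps form_simps d_simps zero_prod_def)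
next
  show "inB (dB (fst (p 0 (inB u) (inA a)))) = p 0 (inB u) (inB (dB a))" for u a
    by (cases u) (simp add: p_0 zero_prod_def actA_simps br_simps d_act)
next
  show "p 0 (inB u) (inA a) = - p 0 (inA a) (inB u)" for u a
    by (cases u) (simp add: p_0 zero_prod_def actA_simps br_simps actU_simps)
next
  \<comment> \<open>The bracket lets only the Lie part of the left factor act, so it fails to be
    skew by the sum of the two actions on \<open>U\<close>; this sum is \<open>d\<close> of the
    first product.\<close>
  show "p 0 (inB u) (inB v) = - p 0 (inB v) (inB u) + inB (dB (fst (p 1 (inB u) (inB v))))" for u v
    by (cases u rule: B_cases; cases v rule: B_cases)
      (simp add: p_0_d p_1 d_simps d_unit actA_simps br_skew[symmetric])
next
  show "p 1 (inB u) (inB v) = p 1 (inB v) (inB u)" for u v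
    by (cases u rule: B_cases; cases v rule: B_cases)
      (simp add: p_1 form_sym algebra_simps)
next
  fix i :: nat and x y z :: "'a \<times> 'g \<times> 'u"
  assume "i \<in> {0, 1}"
  obtain a g u b h v c k w where xyz: "x = (a, g, d u)" "y = (b, h, d v)" "z = (c, k, d w)"
    by (metis C_cases)
  \<comment> \<open>\<open>form (br g h) k = - form (br h g) k = - form h (br g k)\<close>. These
    are the multiples of \<open>e\<close> on the right of the commutator identity; on the left
    \<open>g\<close> kills \<open>e\<close>.\<close>
  have "form h (br g k) + form (br g h) k = 0"
    by (metis form_inv br_skew form_simps(5) add.right_inverse)
  then have inv: "sA (form h (br g k)) e + sA (form (br g h) k) e = 0"
    by (metis A.scale_left_distrib A.scale_zero_left)
  have "actA g (sA (form h k) e + actA h w + actA k v) =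
      sA (form h (br g k)) e + actA h (actA g w) + actA (br g k) v +
      (sA (form (br g h) k) e + actA (br g h) w + actA k (actA g v))"
    using inv by (simp add: actA_simps act_unit actA_bracket algebra_simps)
  then have "p 0 x (p 1 y z) = p 1 y (p 0 x z) + p 1 (p 0 x y) z"
    by (simp add: xyz p_0 p_1 d_act[symmetric] br_simps actU_simps actA_simps)
  moreover have "p 0 x (p 0 y z) = p 0 y (p 0 x z) + p 0 (p 0 x y) z"
    using br_leibniz[of g h k]
    by (simp add: xyz p_0 actA_simps actA_bracket U.bracket_act)
  ultimately show "p 0 x (p i y z) = p i y (p 0 x z) + p i (p 0 x y) z"
    using \<open>i \<in> {0, 1}\<close> by auto
qed

text \<open>Frees the criterion from \<open>p\<close>: the first product of two Lie elements is a
  multiple of \<open>e\<close>, so multiplying by it is scaling.\<close>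

lemma skew_condition_iff:
  "fst (p 0 (inB (g, 0)) (p 0 (inB (g', 0)) (inA a))) +
     fst (p 0 (inB (g', 0)) (p 0 (inB (g, 0)) (inA a))) =
     fst (p 1 (inB (g, 0)) (inB (g', 0))) * a \<longleftrightarrow>
   actA g (actA g' a) + actA g' (actA g a) = sA (form g g') a"
proof -
  have "p 1 (inB (g, 0)) (inB (g', 0)) = inA (sA (form g g') e)"
    using p by (simp add: prescribed_products_def)
  then show ?thesis
    by (simp add: p_0 zero_prod_def actA_simps A.scale_mult A.unit_mult)
qed

end
end

section \<open>The splitting of \<open>A\<close> into multiples of \<open>e\<close> and
  \<open>N\<close>\<close>

context
  fixes N :: "'a set"
  assumes N_subspace: "A.subspace N"
    and N_act: "\<And>g a. a \<in> N \<Longrightarrow> actA g a \<in> N"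
    and N_complement: "complements (A.span {e}) N"
    and N_mult: "\<And>a b. a \<in> N \<Longrightarrow> b \<in> N \<Longrightarrow> a * b = 0"
begin

lemmas N_closed = A.subspace_add[OF N_subspace] A.subspace_scale[OF N_subspace]
  A.subspace_0[OF N_subspace] A.subspace_diff[OF N_subspace]

lemma A_cases:
  obtains c n where "n \<in> N" "a = sA c e + n"
proof -
  obtain s n where "s \<in> A.span {e}" "n \<in> N" "a = s + n"
    using N_complement unfolding complements_def by blast
  then show ?thesis
    using that by (auto simp: A.span_singleton)
qed

text \<open>The product of a square-zero extension: \<open>m * n\<close> drops out by
  \<open>N_mult\<close>.\<close>

lemma mult_decomp:
  assumes "m \<in> N" "n \<in> N"
  shows "(sA b e + m) * (sA c e + n) = sA (b * c) e + (sA b n + sA c m)"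
  using assms by (simp add: algebra_simps A.scale_mult A.unit_mult N_mult mult_scale mult_unit)

lemma act_decomp: "actA g (sA c e + n) = actA g n"
  by (simp add: actA_simps act_unit)

lemma d_decomp: "d (sA c e + n) = d n"
  by (simp add: d_simps d_unit)

text \<open>For \<open>e \<noteq> 0\<close> the coordinate along \<open>e\<close> is a well-defined
  linear functional \<open>coef\<close>, and the required map is scaling by it plus a term from the
  action.\<close>

lemma dot_exists:
  assumes "e \<noteq> 0"
  shows "\<exists>dot. prescribed_dot sA e sg actA sU d N dot"
proof -
  \<comment> \<open>The difference of the two remainders is a multiple of \<open>e\<close> lying in
    \<open>N\<close>, hence 0.\<close>
  have unique: "b = c" if "a - sA b e \<in> N" "a - sA c e \<in> N" for a b c
  proof -
    have "(a - sA c e) - (a - sA b e) \<in> N"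
      using that(2,1) by (rule N_closed(4))
    then have "sA (b - c) e \<in> N"
      by (simp add: A.scale_left_diff_distrib)
    moreover have "sA (b - c) e \<in> A.span {e}"
      by (intro A.span_scale A.span_base) simp
    ultimately have "sA (b - c) e = 0"
      using N_complement unfolding complements_def by blast
    then show ?thesis
      using \<open>e \<noteq> 0\<close> by simp
  qed
  define coef where "coef a = (SOME c. a - sA c e \<in> N)" for a
  have coef: "a - sA (coef a) e \<in> N" for a
  proof -
    obtain c n where "n \<in> N" "a = sA c e + n"
      by (rule A_cases)
    then have "a - sA c e \<in> N"
      by simp
    then show ?thesis
      unfolding coef_def by (rule someI)
  qed
  have coef_eq: "coef a = c" if "a - sA c e \<in> N" for a c
    using unique coef that by blast
  have coef_add: "coef (a + b) = coef a + coef b" for a b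
    using N_closed(1)[OF coef[of a] coef[of b]] by (intro coef_eq) (simp add: algebra_simps)
  have coef_scale: "coef (sA c a) = c * coef a" for a c
    using N_closed(2)[OF coef[of a], of c] by (intro coef_eq) (simp add: algebra_simps)
  have coef_unit: "coef e = 1"
    by (intro coef_eq) (simp add: N_closed)
  have coef_N: "coef n = 0" if "n \<in> N" for n
    using that by (intro coef_eq) simp
  \<comment> \<open>The last term may use all of \<open>a\<close> instead of its part in
    \<open>N\<close>, since the action kills \<open>e\<close>.\<close>
  define dot where
    "dot a v = (sg (coef a) (fst v), sU (coef a) (snd v) + d (actA (fst v) a))" for a v
  have "bilinear_map sA sB sB dot"
    by (auto simp: bilinear_map_iff dot_def A.vector_space_axioms B.p.vector_space_axioms
        B.scale_def coef_add coef_scale actA_simps d_simps mult.commute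
        B.vs1.scale_left_distrib d.vs2.scale_left_distrib B.vs1.scale_right_distrib
        d.vs2.scale_right_distrib algebra_simps)
  then have "prescribed_dot sA e sg actA sU d N dot"
    by (simp add: prescribed_dot_def dot_def coef_unit coef_N act_unit d_simps)
  then show ?thesis
    by blast
qed

section \<open>The algebroid axioms and the criterion\<close>

context
  fixes form p dot
  assumes form: "symmetric_invariant_form sg br form"
    and p: "prescribed_products sA e sg br actA sU actU d form p"
    and dot: "prescribed_dot sA e sg actA sU d N dot"
begin

lemma dot_bilinear: "bilinear_map sA sB sB dot"
  and dot_unit: "dot e v = v"
  and dot_N: "n \<in> N \<Longrightarrow> dot n v = (0, d (actA (fst v) n))"
proof -
  obtain g x where "v = (g, d x)"
    using surj_d by (metis surjD surj_pair)
  then show "bilinear_map sA sB sB dot" "dot e v = v" "n \<in> N \<Longrightarrow> dot n v = (0, d (actA (fst v) n))"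
    using dot by (simp_all add: prescribed_dot_def)
qed

lemma dot_decomp:
  "n \<in> N \<Longrightarrow> dot (sA c e + n) (g, m) = (sg c g, sU c m + d (actA g n))"
  by (simp add: bilinear_map_additive[OF dot_bilinear] dot_unit dot_N B.scale_def)

lemma dot_decomp_d:
  "n \<in> N \<Longrightarrow> dot (sA c e + n) (g, d x) = (sg c g, d (sA c x + actA g n))"
  by (simp add: dot_decomp d_simps)

lemma vertex_algebroid_imp:
  assumes "vertex_algebroid sA e sB dB p dot" and "a \<in> N"
  shows "actA g (actA g' a) + actA g' (actA g a) = sA (form g g') a"
proof -
  interpret V: vertex_algebroid sA e sB dB p dot
    by fact
  \<comment> \<open>The axiom \<open>one_dot\<close> at two Lie elements; zero components are
    written \<open>d 0\<close> to match \<open>p_1\<close>.\<close>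
  have "fst (p 1 (0, 0, d (actA g' a)) (0, g, d 0)) =
      a * fst (p 1 (0, g', d 0) (0, g, d 0)) - actA g' (actA g a)"
    using V.one_dot[of a "(g', 0)" "(g, 0)"] \<open>a \<in> N\<close>
    by (simp add: dot_N p_0[OF form p] zero_prod_def d_simps actA_simps br_simps actU_simps)
  then show ?thesis
    unfolding One_nat_def p_1[OF form p]
    by (simp add: actA_simps form_simps[OF form] form_sym[OF form, of g' g]
        mult_scale mult_unit algebra_simps)
qed

lemma vertex_algebroid_if:
  assumes S: "\<And>a g g'. a \<in> N \<Longrightarrow> actA g (actA g' a) + actA g' (actA g a) = sA (form g g') a"
  shows "vertex_algebroid sA e sB dB p dot"
proof (intro vertex_algebroid.intro vertex_algebroid_axioms.intro)
  show "unital_comm_algebra sA e" ..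
  show "one_truncated_conformal_algebra sA sB dB p"
    using form p by (rule conformal)
  show "bilinear_map sA sB sB dot"
    by (rule dot_bilinear)
  show "dot e v = v" for v
    by (rule dot_unit)
  show "p i (inA a) (inA a') = 0" if "i \<in> {0, 1}" for i a a'
    using that p by (auto simp: prescribed_products_def)
next
  fix a a' :: 'a and u v :: "'g \<times> 'u"
  obtain c n where a: "n \<in> N" "a = sA c e + n"
    by (rule A_cases)
  obtain c' n' where a': "n' \<in> N" "a' = sA c' e + n'"
    by (rule A_cases)
  obtain g x where u: "u = (g, d x)"
    by (rule B_cases[OF form p])
  obtain h y where v: "v = (h, d y)"
    by (rule B_cases[OF form p])
  \<comment> \<open>Preimages of the components in \<open>U\<close> are split too:
    \<open>actA g y = actA g k\<close> then lies in \<open>N\<close>, so its product with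
    \<open>n\<close> vanishes in \<open>one_dot\<close>.\<close>
  obtain b k where y: "k \<in> N" "y = sA b e + k"
    by (rule A_cases)
  obtain b' l where x: "l \<in> N" "x = sA b' e + l"
    by (rule A_cases)
  note N = a(1) a'(1) x(1) y(1) N_act N_closed
  note [simp] = p_0[OF form p] p_1[OF form p] d_act[symmetric] act_decomp
  note zero = actA_simps(3,4) br_simps(3,4) actU_simps(3,4)
  \<comment> \<open>Both sides are 0. On the left the mixed terms from \<open>n\<close> and
    \<open>n'\<close> cancel; on the right elements of \<open>N\<close> multiply elements of
    \<open>U\<close>, which gives 0.\<close>
  show "dot a (dot a' u) - dot (a * a') u =
      dot (fst (p 0 (inB u) (inA a))) (dB a') + dot (fst (p 0 (inB u) (inA a'))) (dB a)"
    unfolding a(2) a'(2) mult_decomp[OF a(1) a'(1)] u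
    by (simp add: N dot_N dot_decomp d_decomp zero_prod_def zero)
      (simp add: actA_simps d_simps d.vs2.scale_right_distrib mult.commute)
  \<comment> \<open>The terms with \<open>c\<close> cancel, and what remains is \<open>d\<close> of
    \<open>actA g (actA h n) - actA (br g h) n = actA h (actA g n)\<close>.\<close>
  show "snd (p 0 (inB u) (inB (dot a v))) - dot a (snd (p 0 (inB u) (inB v))) =
      dot (fst (p 0 (inB u) (inA a))) v"
    unfolding a(2) u v
    by (simp add: N dot_N dot_decomp zero_prod_def zero br_simps actU_simps d_simps actA_bracket)
  show "fst (p 0 (inB u) (inA (a * a'))) =
      a * fst (p 0 (inB u) (inA a')) + fst (p 0 (inB u) (inA a)) * a'"
    unfolding u by (simp add: zero_prod_def zero actA_mult)
  show "fst (p 0 (inA a) (inB (dot a' v))) = a' * fst (p 0 (inA a) (inB v))"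
    unfolding a(2) a'(2) v
    by (simp add: N dot_decomp zero_prod_def zero actA_simps(9) distrib_right N_mult A.scale_mult
        A.unit_mult)
  show "dB (a * a') = dot a (dB a') + dot a' (dB a)"
    unfolding a(2) a'(2) mult_decomp[OF a(1) a'(1)]
    by (simp add: N dot_decomp d_decomp zero d_simps d_unit B.vs1.scale_zero_right)
  \<comment> \<open>What \<open>one_dot\<close> amounts to once the terms with \<open>c\<close>
    cancel and products of two elements of \<open>N\<close> vanish; here \<open>S\<close>
    enters.\<close>
  have "actA h (actA g n) = sA (form g h) n - actA g (actA h n)"
    using S[OF a(1), of g h] by (simp add: algebra_simps)
  then show "fst (p 1 (inB (dot a u)) (inB v)) =
      a * fst (p 1 (inB u) (inB v)) - fst (p 0 (inB u) (p 0 (inB v) (inA a)))"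
    unfolding a(2) u v x(2) y(2)
    by (simp add: N dot_decomp_d zero_prod_def zero)
      (simp add: N N_mult A.scale_mult A.unit_mult form_simps[OF form] mult_unit mult_scale
        actA_simps act_unit algebra_simps)
qed

end
end
end

theorem theorem10:
  fixes sA :: "complex \<Rightarrow> 'a::comm_ring \<Rightarrow> 'a" and e :: 'a
    and sg :: "complex \<Rightarrow> 'g::ab_group_add \<Rightarrow> 'g" and br :: "'g \<Rightarrow> 'g \<Rightarrow> 'g"
    and actA :: "'g \<Rightarrow> 'a \<Rightarrow> 'a"
    and sU :: "complex \<Rightarrow> 'u::ab_group_add \<Rightarrow> 'u" and actU :: "'g \<Rightarrow> 'u \<Rightarrow> 'u"
    and d :: "'a \<Rightarrow> 'u"
  assumes "unital_comm_algebra sA e"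
    and "lie_algebra sg br"
    and "acts_by_derivations sg br sA actA"
    and "bracket_module sg br sU actU"
    and "Vector_Spaces.linear sA sU d"
    and "\<And>x a. d (actA x a) = actU x (d a)"
    and "surj d"
    and "d e = 0"
  shows
    "(left_leibniz_algebra (module_prod.scale sg sU) (B_bracket br actU) \<and>
      bracket_module (module_prod.scale sg sU) (B_bracket br actU) sA (B_act actA)) \<and>
     (\<forall>form. symmetric_invariant_form sg br form \<longrightarrow>
        ((\<forall>a. d a = 0 \<longrightarrow> (\<forall>g. actA g a = 0)) \<longrightarrow>
           (\<exists>p. prescribed_products sA e sg br actA sU actU d form p)) \<and>
        (\<forall>p. prescribed_products sA e sg br actA sU actU d form p \<longrightarrow>
           one_truncated_conformal_algebra sA (module_prod.scale sg sU) (\<lambda>a. (0, d a)) p)) \<and>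
     (\<forall>form N. symmetric_invariant_form sg br form \<and>
        module.subspace sA N \<and> (\<forall>g. \<forall>a\<in>N. actA g a \<in> N) \<and>
        complements (module.span sA {e}) N \<and>
        bij_betw d N (d ` N) \<and>
        (\<forall>a\<in>N. \<forall>a'\<in>N. a * a' = 0) \<longrightarrow>
        (e \<noteq> 0 \<longrightarrow> (\<exists>dot. prescribed_dot sA e sg actA sU d N dot)) \<and>
        (\<forall>p dot. prescribed_products sA e sg br actA sU actU d form p \<and>
           prescribed_dot sA e sg actA sU d N dot \<longrightarrow>
           (vertex_algebroid sA e (module_prod.scale sg sU) (\<lambda>a. (0, d a)) p dot \<longleftrightarrow>
            (\<forall>a\<in>N. \<forall>g g'.
               fst (p 0 (inB (g, 0)) (p 0 (inB (g', 0)) (inA a))) +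
               fst (p 0 (inB (g', 0)) (p 0 (inB (g, 0)) (inA a))) =
               fst (p 1 (inB (g, 0)) (inB (g', 0))) * a))))"
proof -
  interpret algebroid_data sA e sg br actA sU actU d
    using assms by (simp add: algebroid_data_def algebroid_data_axioms_def)
  show ?thesis
  proof (intro conjI allI impI)
    show "left_leibniz_algebra sB (B_bracket br actU)"
      by (rule B_leibniz)
    show "bracket_module sB (B_bracket br actU) sA (B_act actA)"
      by (rule B_module)
  next
    fix form
    assume form: "symmetric_invariant_form sg br form"
    show "\<exists>p. prescribed_products sA e sg br actA sU actU d form p"
      if "\<forall>a. d a = 0 \<longrightarrow> (\<forall>g. actA g a = 0)"
      using products_exist[OF form] that by blast
    show "one_truncated_conformal_algebra sA sB dB p"
      if "prescribed_products sA e sg br actA sU actU d form p" for p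
      using form that by (rule conformal)
  next
    fix form N
    assume *: "symmetric_invariant_form sg br form \<and>
        A.subspace N \<and> (\<forall>g. \<forall>a\<in>N. actA g a \<in> N) \<and>
        complements (A.span {e}) N \<and> bij_betw d N (d ` N) \<and> (\<forall>a\<in>N. \<forall>a'\<in>N. a * a' = 0)"
    then have form: "symmetric_invariant_form sg br form"
      by blast
    have N: "A.subspace N" "\<And>g a. a \<in> N \<Longrightarrow> actA g a \<in> N" "complements (A.span {e}) N"
      "\<And>a b. a \<in> N \<Longrightarrow> b \<in> N \<Longrightarrow> a * b = 0"
      using * by blast+
    show "\<exists>dot. prescribed_dot sA e sg actA sU d N dot" if "e \<noteq> 0"
      using N that by (rule dot_exists)
    fix p dot
    assume "prescribed_products sA e sg br actA sU actU d form p \<and>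
      prescribed_dot sA e sg actA sU d N dot"
    then have p: "prescribed_products sA e sg br actA sU actU d form p"
      and dot: "prescribed_dot sA e sg actA sU d N dot"
      by blast+
    show "vertex_algebroid sA e sB dB p dot \<longleftrightarrow>
        (\<forall>a\<in>N. \<forall>g g'.
           fst (p 0 (inB (g, 0)) (p 0 (inB (g', 0)) (inA a))) +
           fst (p 0 (inB (g', 0)) (p 0 (inB (g, 0)) (inA a))) =
           fst (p 1 (inB (g, 0)) (inB (g', 0))) * a)"
      unfolding skew_condition_iff[OF form p]
      using vertex_algebroid_imp[OF N form p dot] vertex_algebroid_if[OF N form p dot] by blast
  qed
qed

end
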